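(* For each $k\in\{5,6,7,8,9,10\}$, the admissible triples $(t,\lambda_1,\lambda_2)$ of valency $k$ are exactly the following. \begin{itemize} \item $k=5$: $(4,5,-1)$, $(0,\sqrt5,-\sqrt5)$, $(-4,1,-5)$. \item $k=6$: $(5,6,-1)$, $(1,3,-2)$, $(0,\sqrt6,-\sqrt6)$, $(-1,2,-3)$, $(-5,1,-6)$. \item $k=7$: $(6,7,-1)$, $(0,\sqrt7,-\sqrt7)$, $(-6,1,-7)$. \item $k=8$: $(7,8,-1)$, $(2,4,-2)$, $(0,\sqrt8,-\sqrt8)$, $(-2,2,-4)$, $(-7,1,-8)$. \item $k=9$: $(8,9,-1)$, $(0,3,-3)$, $(-8,1,-9)$. \item $k=10$: $(9,10,-1)$, $(3,5,-2)$, $(0,\sqrt{10},-\sqrt{10})$, $(-3,2,-5)$, $(-9,1,-10)$. \end{itemize}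
   Context: These triples are the possible parameters of a signed $k$-regular graph with exactly two distinct eigenvalues $\lambda_1>\lambda_2$, whose adjacency matrix $A$ satisfies $A^2-tA-kI=0$. For a positive integer $k$, a triple $(t,\lambda_1,\lambda_2)$ is called admissible of valency $k$ if $t$ is an integer in the interval $[-k+1,k-1]$, $\lambda_1=\frac{t+\sqrt{t^2+4k}}{2}$ and $\lambda_2=\frac{t-\sqrt{t^2+4k}}{2}$ (so $t=\lambda_1+\lambda_2$ and $k=-\lambda_1\lambda_2$), and either $t=0$ or $b=t^2+4k$ is a perfect square. *)

theory Defs
  imports Complex_Main "HOL-Computational_Algebra.Nth_Powers"
begin

text \<open>
  The valency \<open>k\<close> is meant to be positive; for \<open>k = 0\<close> the interval
  \<open>[-k+1, k-1]\<close> is empty, so no triple is admissible.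
\<close>

definition admissible :: "nat \<Rightarrow> int \<times> real \<times> real \<Rightarrow> bool" where
  "admissible k = (\<lambda>(t, l1, l2).
     t \<in> {- int k + 1..int k - 1} \<and>
     l1 = (of_int t + sqrt (of_int t ^ 2 + 4 * of_nat k)) / 2 \<and>
     l2 = (of_int t - sqrt (of_int t ^ 2 + 4 * of_nat k)) / 2 \<and>
     (t = 0 \<or> is_square (t ^ 2 + 4 * int k)))"

end

theory Submission
  imports Defs
begin

text \<open>
  The numbers $\lambda_1$ and $-\lambda_2$ have product $k$ and difference $t$. If $t^2 + 4k = s^2$ then
  $s$ and $t$ have the same parity, so both are integers; hence the triples with $t^2 + 4k$ a square
  correspond to the factorizations $k = ab$, and the only other one has $t = 0$.
\<close>

text \<open>For \<open>t = a - b\<close> and \<open>k = a * b\<close> the discriminant is the square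
  of \<open>a + b\<close>, so the two eigenvalues collapse to \<open>a\<close> and
  \<open>- b\<close>.\<close>

lemma sqrt_square_diff_add_4_mult:
  fixes a b :: real
  assumes "a \<ge> 0" "b \<ge> 0"
  shows "sqrt ((a - b)\<^sup>2 + 4 * (a * b)) = a + b"
proof -
  have "(a - b)\<^sup>2 + 4 * (a * b) = (a + b)\<^sup>2"
    by (simp add: power2_eq_square algebra_simps)
  with assms show ?thesis by simp
qed

lemma factorization_if_is_square:
  fixes t :: int
  assumes "k > 0" and "is_square (t\<^sup>2 + 4 * int k)"
  obtains a b where "k = a * b" "t = int a - int b"
proof -
  obtain r where r: "t\<^sup>2 + 4 * int k = r\<^sup>2"
    using assms(2) by (auto simp: is_nth_power_def)
  \<comment> \<open>The nonnegative root is taken so that \<open>x\<close> and \<open>y\<close>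
    below, which are (s + t)/2 and (s - t)/2, have a nonnegative sum.\<close>
  define s where "s = \<bar>r\<bar>"
  have s: "s\<^sup>2 = t\<^sup>2 + 4 * int k" and "s \<ge> 0"
    using r by (simp_all add: s_def)
  have "even (s\<^sup>2) = even (t\<^sup>2)"
    unfolding s by simp
  then have "even (s + t)" by simp
  then obtain x where x: "s + t = 2 * x" by blast
  define y where "y = x - t"
  have st: "s = x + y" "t = x - y"
    using x by (simp_all add: y_def)
  have xy: "x * y = int k"
    using s by (simp add: st power2_eq_square algebra_simps)
  \<comment> \<open>A positive product forces equal signs, and \<open>x + y = s \<ge> 0\<close>
    excludes two negative factors.\<close>
  have "x > 0 \<and> y > 0"
    using xy \<open>k > 0\<close> \<open>s \<ge> 0\<close> st(1) zero_less_mult_iff[of x y] by auto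
  then have "k = nat x * nat y" "t = int (nat x) - int (nat y)"
    using xy st(2) by (simp_all flip: nat_mult_distrib)
  then show thesis by (rule that)
qed

lemma admissible_of_factorization:
  assumes "a > 0" "b > 0"
  shows "admissible (a * b) (int a - int b, real a, - real b)"
proof -
  \<comment> \<open>Together with \<open>a, b \<ge> 1\<close> these bound \<open>a - b\<close> and
    \<open>b - a\<close> by \<open>a * b - 1\<close>, which is the required interval.\<close>
  have "a \<le> a * b" "b \<le> a * b"
    using assms by simp_all
  then have range: "int a - int b \<in> {- int (a * b) + 1..int (a * b) - 1}"
    using assms unfolding atLeastAtMost_iff by linarith
  have "(int a - int b)\<^sup>2 + 4 * int (a * b) = (int a + int b)\<^sup>2"
    by (simp add: power2_eq_square algebra_simps)
  then have "is_square ((int a - int b)\<^sup>2 + 4 * int (a * b))"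
    by simp
  with range show ?thesis
    by (simp add: admissible_def sqrt_square_diff_add_4_mult)
qed

lemma admissible_zero_iff:
  assumes "k > 0"
  shows "admissible k (0, l1, l2) \<longleftrightarrow> l1 = sqrt (real k) \<and> l2 = - sqrt (real k)"
  using assms by (auto simp: admissible_def real_sqrt_mult)

text \<open>This reduces each valency to listing divisors. The two parts may overlap: if
  \<open>k\<close> is a square, the divisor \<open>a\<close> with \<open>a * a = k\<close> also
  gives the inserted triple.\<close>

lemma admissible_triples_eq:
  assumes "k > 0"
  shows "{T. admissible k T} =
    insert (0, sqrt (real k), - sqrt (real k))
      ((\<lambda>a. (int a - int (k div a), real a, - real (k div a))) ` {a. a dvd k})"
    (is "_ = insert ?z (?f ` _)")
proof (intro equalityI subsetI)
  fix T assume "T \<in> {T. admissible k T}"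
  then obtain t l1 l2 where T: "T = (t, l1, l2)" and adm: "admissible k (t, l1, l2)"
    by (cases T) auto
  show "T \<in> insert ?z (?f ` {a. a dvd k})"
  proof (cases "t = 0")
    case True
    then show ?thesis
      using T adm assms by (simp add: admissible_zero_iff)
  next
    case False
    then have "is_square (t\<^sup>2 + 4 * int k)"
      using adm by (simp add: admissible_def)
    then obtain a b where ab: "k = a * b" "t = int a - int b"
      using factorization_if_is_square assms by blast
    have "l1 = real a" "l2 = - real b"
      using adm by (simp_all add: admissible_def ab sqrt_square_diff_add_4_mult)
    moreover have "k div a = b"
      using ab(1) assms by simp
    ultimately have "T = ?f a"
      by (simp add: T ab(2))
    moreover have "a dvd k"
      using ab(1) by simp
    ultimately show ?thesis by blast
  qed
next
  fix T assume "T \<in> insert ?z (?f ` {a. a dvd k})"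
  then consider "T = ?z" | a where "a dvd k" "T = ?f a" by blast
  then show "T \<in> {T. admissible k T}"
  proof cases
    case 1
    then show ?thesis
      using assms by (simp add: admissible_zero_iff)
  next
    case 2
    then obtain b where "k = a * b" by blast
    with assms 2 show ?thesis
      using admissible_of_factorization[of a b] by simp
  qed
qed

text \<open>Positive \<open>k\<close> bounds its divisors, so the set becomes a finite list that can
  be evaluated for numerals.\<close>

lemma divisors_eq_filter:
  fixes k :: nat
  assumes "k > 0"
  shows "{a. a dvd k} = set (filter (\<lambda>a. a dvd k) [1..<Suc k])"
  using assms by (auto simp: dvd_imp_le Suc_le_eq intro: Nat.gr0I)

theorem theorem2p2:
  shows "{T. admissible 5 T} =
           {(4, 5, -1), (0, sqrt 5, - sqrt 5), (-4, 1, -5)}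
       \<and> {T. admissible 6 T} =
           {(5, 6, -1), (1, 3, -2), (0, sqrt 6, - sqrt 6), (-1, 2, -3), (-5, 1, -6)}
       \<and> {T. admissible 7 T} =
           {(6, 7, -1), (0, sqrt 7, - sqrt 7), (-6, 1, -7)}
       \<and> {T. admissible 8 T} =
           {(7, 8, -1), (2, 4, -2), (0, sqrt 8, - sqrt 8), (-2, 2, -4), (-7, 1, -8)}
       \<and> {T. admissible 9 T} =
           {(8, 9, -1), (0, 3, -3), (-8, 1, -9)}
       \<and> {T. admissible 10 T} =
           {(9, 10, -1), (3, 5, -2), (0, sqrt 10, - sqrt 10), (-3, 2, -5), (-9, 1, -10)}"
proof -
  have divisors: "{a. a dvd 5} = {1, 5::nat}" "{a. a dvd 6} = {1, 2, 3, 6::nat}"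
    "{a. a dvd 7} = {1, 7::nat}" "{a. a dvd 8} = {1, 2, 4, 8::nat}"
    "{a. a dvd 9} = {1, 3, 9::nat}" "{a. a dvd 10} = {1, 2, 5, 10::nat}"
    unfolding divisors_eq_filter[OF zero_less_numeral] by code_simp+
  \<comment> \<open>For \<open>k = 9\<close> this identifies the triple with \<open>t = 0\<close>
    with the one from the divisor 3.\<close>
  have "sqrt 9 = (3 :: real)"
    by (rule real_sqrt_unique) simp_all
  then show ?thesis
    unfolding admissible_triples_eq[OF zero_less_numeral] divisors
    \<comment> \<open>The computed sets start with the triple for \<open>t = 0\<close> and then
      follow increasing divisors, so only the order of the elements remains to be adjusted.\<close>
    by (simp add: insert_commute)
qed

end
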